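(* The optimal asymptotic performance ratio $\mathcal{R}^\infty_{\Pi_d}$ of the online bounded space $d$-hypercube bin packing problem $\Pi_d$ is $\Omega(d/\log d)$; that is, there are absolute constants $c>0$ and $d_0$ such that for every $d\geq d_0$ and every online bounded space algorithm $A$ for $\Pi_d$, we have $\mathcal{R}^\infty_A\geq c\,d/\log d$.
   Context: In the $d$-hypercube bin packing problem one is given a list $L$ of $d$-dimensional hypercubes, each of side length at most $1$, and an unlimited supply of bins, each the unit hypercube $[0,1]^d$. The items must be assigned to bins and placed axis-parallel inside their bin so that no two items in the same bin overlap (their interiors are disjoint); the goal is to minimize the number of used bins. In the online bounded space variant, the hypercubes arrive one at a time and each must be packed, without knowledge of future items, into an open bin; a newly used bin is open until it is declared closed, after which it accepts no more items; at every moment at most a constant number (depending on the algorithm, not on the input) of bins may be open. For an algorithm $A$ and list $L$, let $A(L)$ be the number of bins used by $A$ and ${\rm OPT}(L)$ the minimum (offline) number of bins needed to pack $L$. The asymptotic performance ratio of $A$ is $\mathcal{R}_A^\infty=\limsup_{n\to\infty}\sup_L\{A(L)/{\rm OPT}(L):{\rm OPT}(L)=n\}$, and the optimal asymptotic performance ratio of the problem is the infimum of $\mathcal{R}_A^\infty$ over all algorithms $A$ for it. Here $\log$ is the natural logarithm. *)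

theory Defs
  imports Complex_Main "HOL-Library.FuncSet" "HOL-Library.Extended_Real"
    "HOL-Library.Liminf_Limsup"
begin

text \<open>
  Since the dimension \<open>d\<close> has to be quantified inside formulas, points of \<open>d\<close>-dimensional space are
  extensional functions on \<open>{..<d}\<close>. An item is given by its side length; a position is the corner
  of the placed item with the smallest coordinates (only the coordinates below \<open>d\<close> matter).
\<close>

definition cube :: "nat \<Rightarrow> (nat \<Rightarrow> real) \<Rightarrow> real \<Rightarrow> (nat \<Rightarrow> real) set" where
  "cube d p s = (\<Pi>\<^sub>E k\<in>{..<d}. {p k..p k + s})"

text \<open>The interior of \<^term>\<open>cube d p s\<close> in \<open>d\<close>-dimensional space.\<close>

definition open_cube :: "nat \<Rightarrow> (nat \<Rightarrow> real) \<Rightarrow> real \<Rightarrow> (nat \<Rightarrow> real) set" where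
  "open_cube d p s = (\<Pi>\<^sub>E k\<in>{..<d}. {p k<..<p k + s})"

definition unit_cube :: "nat \<Rightarrow> (nat \<Rightarrow> real) set" where
  "unit_cube d = cube d (\<lambda>_. 0) 1"

definition instances :: "real list set" where
  "instances = {L. \<forall>s\<in>set L. 0 < s \<and> s \<le> 1}"

text \<open>Item number \<open>i\<close> of \<open>L\<close> goes to bin \<open>b i\<close>, at position \<open>p i\<close>.\<close>

definition packing ::
  "nat \<Rightarrow> real list \<Rightarrow> (nat \<Rightarrow> nat) \<Rightarrow> (nat \<Rightarrow> nat \<Rightarrow> real) \<Rightarrow> bool" where
  "packing d L b p \<longleftrightarrow>
     (\<forall>i<length L. cube d (p i) (L ! i) \<subseteq> unit_cube d) \<and>
     (\<forall>i<length L. \<forall>j<length L. i \<noteq> j \<and> b i = b j \<longrightarrow>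
        open_cube d (p i) (L ! i) \<inter> open_cube d (p j) (L ! j) = {})"

definition bins_used :: "real list \<Rightarrow> (nat \<Rightarrow> nat) \<Rightarrow> nat set" where
  "bins_used L b = b ` {..<length L}"

definition OPT :: "nat \<Rightarrow> real list \<Rightarrow> nat" where
  "OPT d L = (LEAST n. \<exists>b p. packing d L b p \<and> card (bins_used L b) = n)"

text \<open>
  A deterministic online algorithm is a function of the list of items that have arrived so far.
  For a nonempty list \<open>L\<close>, \<open>bin_of A L\<close> and \<open>pos_of A L\<close> tell where the last item of \<open>L\<close> is packed;
  \<open>open_bins A L\<close> is the set of bins that are open after all of \<open>L\<close> has been packed.
\<close>

record algorithm =
  bin_of :: "real list \<Rightarrow> nat"
  pos_of :: "real list \<Rightarrow> nat \<Rightarrow> real"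
  open_bins :: "real list \<Rightarrow> nat set"

definition alg_bin :: "algorithm \<Rightarrow> real list \<Rightarrow> nat \<Rightarrow> nat" where
  "alg_bin A L i = bin_of A (take (Suc i) L)"

definition alg_pos :: "algorithm \<Rightarrow> real list \<Rightarrow> nat \<Rightarrow> nat \<Rightarrow> real" where
  "alg_pos A L i = pos_of A (take (Suc i) L)"

definition alg_bins_used :: "algorithm \<Rightarrow> real list \<Rightarrow> nat set" where
  "alg_bins_used A L = bins_used L (alg_bin A L)"

definition online_algorithm :: "nat \<Rightarrow> algorithm \<Rightarrow> bool" where
  "online_algorithm d A \<longleftrightarrow> (\<forall>L\<in>instances. packing d L (alg_bin A L) (alg_pos A L))"

text \<open>
  Every item is packed into a bin that is still open or into a bin never used before, and a bin
  that is not open any more is never reopened. The bound \<open>K\<close> may depend on the algorithm only;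
  as \<open>K\<close> is arbitrary, counting the open bins between two arrivals is no restriction.
\<close>

definition bounded_space :: "algorithm \<Rightarrow> bool" where
  "bounded_space A \<longleftrightarrow>
     open_bins A [] = {} \<and>
     (\<forall>L s. L @ [s] \<in> instances \<longrightarrow>
        (bin_of A (L @ [s]) \<in> open_bins A L \<or> bin_of A (L @ [s]) \<notin> alg_bins_used A L) \<and>
        open_bins A (L @ [s]) \<subseteq> insert (bin_of A (L @ [s])) (open_bins A L)) \<and>
     (\<exists>K. \<forall>L\<in>instances. finite (open_bins A L) \<and> card (open_bins A L) \<le> K)"

definition online_bounded_space_algorithms :: "nat \<Rightarrow> algorithm set" where
  "online_bounded_space_algorithms d = {A. online_algorithm d A \<and> bounded_space A}"

definition asymptotic_ratio :: "nat \<Rightarrow> algorithm \<Rightarrow> ereal" where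
  "asymptotic_ratio d A =
     limsup (\<lambda>n. SUP L\<in>{L\<in>instances. OPT d L = n}.
       ereal (real (card (alg_bins_used A L)) / real (OPT d L)))"

definition optimal_asymptotic_ratio :: "nat \<Rightarrow> ereal" where
  "optimal_asymptotic_ratio d =
     (INF A\<in>online_bounded_space_algorithms d. asymptotic_ratio d A)"

end

theory Submission
  imports Defs
begin

text \<open>
  For \<open>q = 1, \<dots>, M\<close> with \<open>M\<close> about \<open>d / (8 ln d)\<close>, consider items of side slightly larger than
  \<open>1 / (q + 1)\<close>; at most \<open>q\<^sup>d\<close> of them fit into one bin. If they arrive class by class, a bounded
  space algorithm can mix two classes in boundedly many bins only. So if some single bin holds
  \<open>n\<^sub>q \<ge> q\<^sup>d / 2\<close> items of every class \<open>q\<close> at once, then \<open>N\<close> copies of its content force the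
  algorithm to use \<open>\<Sum>\<^sub>q N n\<^sub>q / q\<^sup>d - O(1) \<ge> N M / 2 - O(1)\<close> bins, while the optimum is \<open>N\<close>.

  To build such a bin, arrange class \<open>q\<close> in a grid of \<open>q\<close> slots per coordinate, aligned with the
  left end of \<open>[0,1]\<close> in the coordinates of a set \<open>C\<^sub>q\<close> and with the right end elsewhere. For \<open>k < q\<close>,
  the rightmost slot of class \<open>q\<close> in a coordinate of \<open>C\<^sub>k - C\<^sub>q\<close> misses all slots of class \<open>k\<close>. With
  \<open>C\<close> a code such that \<open>|C\<^sub>k - C\<^sub>q| \<ge> d / 8\<close>, at most \<open>q exp (- d / (8 q)) \<le> 1 / 2\<close> of the \<open>q\<^sup>d\<close> grid
  cells fail to use such a slot for some \<open>k\<close>, and all the other cells can be filled.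
\<close>

section \<open>Codes with large asymmetric differences\<close>

text \<open>Sylvester's construction of Hadamard matrices, with signs written as truth values:
  orthogonality of two rows means that they differ in exactly half of the positions.\<close>

lemma hadamard_code:
  "\<exists>f::nat \<Rightarrow> nat \<Rightarrow> bool. \<forall>k<2^m. \<forall>l<2^m. k \<noteq> l \<longrightarrow>
     2 * card {i. i < 2^m \<and> f k i \<noteq> f l i} = 2^m"
proof (induction m)
  case 0
  then show ?case by auto
next
  case (Suc m)
  define n :: nat where "n = 2^m"
  have n: "n > 0" by (simp add: n_def)
  from Suc obtain f :: "nat \<Rightarrow> nat \<Rightarrow> bool"
    where f: "\<And>k l. k < n \<Longrightarrow> l < n \<Longrightarrow> k \<noteq> l \<Longrightarrow>
      2 * card {i. i < n \<and> f k i \<noteq> f l i} = n"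
    unfolding n_def by blast
  \<comment> \<open>The doubled matrix consists of four copies of \<open>f\<close>, the lower right
    one negated.\<close>
  define g where "g k i = (f (k mod n) (i mod n) \<noteq> (n \<le> k \<and> n \<le> i))" for k i
  have "2 * card {i. i < 2 * n \<and> g k i \<noteq> g l i} = 2 * n"
    if k: "k < 2 * n" and l: "l < 2 * n" and "k \<noteq> l" for k l
  proof -
    let ?E = "{i. i < n \<and> f (k mod n) i \<noteq> f (l mod n) i}"
    \<comment> \<open>Mismatches in the second half of the columns. If exactly one of the two rows
      is negated there, agreements and mismatches are exchanged, so \<open>?E'\<close> is the
      complement of \<open>?E\<close>.\<close>
    let ?E' = "{i. i < n \<and> (f (k mod n) i \<noteq> f (l mod n) i) = ((n \<le> k) = (n \<le> l))}"
    have mods: "k mod n = (if n \<le> k then k - n else k)" "l mod n = (if n \<le> l then l - n else l)"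
      using k l by (auto simp: mod_if)
    have "{i. i < 2 * n \<and> g k i \<noteq> g l i} = ?E \<union> (\<lambda>i. n + i) ` ?E'" (is "?S = _")
    proof (intro set_eqI iffI)
      fix i assume i: "i \<in> ?S"
      show "i \<in> ?E \<union> (\<lambda>i. n + i) ` ?E'"
      proof (cases "i < n")
        case True
        then show ?thesis using i by (auto simp: g_def)
      next
        case False
        then obtain j where j: "i = n + j" using le_Suc_ex not_less by blast
        then have "j \<in> ?E'" using i by (auto simp: g_def)
        then show ?thesis using j by blast
      qed
    qed (auto simp: g_def)
    moreover have "card (?E \<union> (\<lambda>i. n + i) ` ?E') = card ?E + card ?E'"
      by (subst card_Un_disjoint) (auto simp: card_image)
    moreover have "card ?E + card ?E' = n"
    proof (cases "k mod n = l mod n")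
      case True
      then have "(n \<le> k) \<noteq> (n \<le> l)"
        using mods \<open>k \<noteq> l\<close> by (auto split: if_splits)
      then have "?E' = {..<n}" "?E = {}" using True by auto
      then show ?thesis by simp
    next
      case False
      have E: "2 * card ?E = n" using f[OF _ _ False] n by simp
      show ?thesis
      proof (cases "(n \<le> k) = (n \<le> l)")
        case True
        then have "?E' = ?E" by auto
        then show ?thesis using E by simp
      next
        case False
        then have "?E' = {..<n} - ?E" by auto
        moreover have "card ({..<n} - ?E) = n - card ?E"
          by (subst card_Diff_subset) auto
        ultimately show ?thesis using E by simp
      qed
    qed
    ultimately show ?thesis by simp
  qed
  then show ?case
    by (intro exI[of _ g]) (simp add: n_def)
qed

text \<open>Appending to each Hadamard codeword its complement makes the asymmetric differences large.\<close>

lemma asymmetric_code: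
  "\<exists>C::nat \<Rightarrow> nat set. \<forall>k<2^m. \<forall>l<2^m. k \<noteq> l \<longrightarrow>
     2 * card ((C k - C l) \<inter> {..<2 * 2^m}) = 2^m"
proof -
  define n :: nat where "n = 2^m"
  obtain f :: "nat \<Rightarrow> nat \<Rightarrow> bool"
    where f: "\<And>k l. k < n \<Longrightarrow> l < n \<Longrightarrow> k \<noteq> l \<Longrightarrow>
      2 * card {i. i < n \<and> f k i \<noteq> f l i} = n"
    using hadamard_code[of m] unfolding n_def by blast
  define C where "C k = {i. if i < n then f k i else \<not> f k (i - n)}" for k
  \<comment> \<open>A position \<open>i\<close> where the codewords differ contributes exactly one
    element to \<open>C k - C l\<close>: \<open>i\<close> if \<open>f k i\<close> is true, and
    \<open>i + n\<close> otherwise.\<close>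
  have "card ((C k - C l) \<inter> {..<2 * n}) = card {i. i < n \<and> f k i \<noteq> f l i}" for k l
  proof (rule bij_betw_same_card[of "\<lambda>i. i mod n"], rule bij_betw_imageI)
    show "inj_on (\<lambda>i. i mod n) ((C k - C l) \<inter> {..<2 * n})"
      by (auto simp: inj_on_def C_def mod_if split: if_splits)
    show "(\<lambda>i. i mod n) ` ((C k - C l) \<inter> {..<2 * n}) = {i. i < n \<and> f k i \<noteq> f l i}"
      (is "?g ` ?S = ?T")
    proof (intro set_eqI iffI)
      fix j assume "j \<in> ?g ` ?S"
      then show "j \<in> ?T" by (auto simp: C_def mod_if split: if_splits)
    next
      fix j assume j: "j \<in> ?T"
      show "j \<in> ?g ` ?S"
      proof (cases "f k j")
        case True
        with j show ?thesis by (intro image_eqI[of _ _ j]) (auto simp: C_def)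
      next
        case False
        with j show ?thesis by (intro image_eqI[of _ _ "j + n"]) (auto simp: C_def)
      qed
    qed
  qed
  with f show ?thesis unfolding n_def by (intro exI[of _ C]) simp
qed

section \<open>Geometry of cubes and capacity of bins\<close>

lemma cube_subset_unit_cube_iff:
  assumes "0 < s"
  shows "cube d p s \<subseteq> unit_cube d \<longleftrightarrow> (\<forall>k<d. 0 \<le> p k \<and> p k + s \<le> 1)"
  using assms unfolding cube_def unit_cube_def by (auto simp: subset_PiE PiE_eq_empty_iff)

lemma open_cubes_disjointI:
  assumes "k < d" "p k + s \<le> p' k \<or> p' k + s' \<le> p k"
  shows "open_cube d p s \<inter> open_cube d p' s' = {}"
proof -
  have "False" if "x \<in> open_cube d p s" "x \<in> open_cube d p' s'" for x
    using PiE_mem[OF that(1)[unfolded open_cube_def], of k]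
      PiE_mem[OF that(2)[unfolded open_cube_def], of k] assms by auto
  then show ?thesis by blast
qed

text \<open>
  Every item of side greater than \<open>1 / (q + 1)\<close> contains a point of the grid
  \<open>{1 / (q + 1), \<dots>, q / (q + 1)}\<^sup>d\<close> in its interior.
\<close>

lemma card_large_items_le:
  assumes P: "packing d L b p" and I: "I \<subseteq> {..<length L}"
    and large: "\<And>i. i \<in> I \<Longrightarrow> 1 / (real q + 1) < L ! i"
  shows "card I \<le> card (b ` I) * q ^ d"
proof -
  \<comment> \<open>Floor plus one, not the ceiling: the grid point has to lie strictly beyond
    \<open>p i k\<close> even if \<open>p i k\<close> is itself a multiple of
    \<open>1 / (q + 1)\<close>.\<close>
  define g where "g i = (\<lambda>k\<in>{..<d}. nat (\<lfloor>p i k * (real q + 1)\<rfloor> + 1))" for i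
  define c where "c i = (\<lambda>k\<in>{..<d}. real (g i k) / (real q + 1))" for i
  have pos: "0 < L ! i" if "i \<in> I" for i
    using large[OF that] by (smt (verit) divide_pos_pos of_nat_0_le_iff)
  have g: "p i k < real (g i k) / (real q + 1) \<and> real (g i k) / (real q + 1) < p i k + L ! i
      \<and> g i k \<in> {1..q}" if i: "i \<in> I" and k: "k < d" for i k
  proof -
    have "cube d (p i) (L ! i) \<subseteq> unit_cube d" using P I i by (auto simp: packing_def)
    then have p: "0 \<le> p i k" "p i k + L ! i \<le> 1"
      using k pos[OF i] by (auto simp: cube_subset_unit_cube_iff)
    define z where "z = \<lfloor>p i k * (real q + 1)\<rfloor>"
    have z: "0 \<le> z" "z \<le> p i k * (real q + 1)" "p i k * (real q + 1) < z + 1"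
      using p unfolding z_def by (auto simp: le_floor_iff)
    have gk: "real (g i k) = z + 1" using z(1) k by (simp add: g_def z_def)
    have 1: "p i k < real (g i k) / (real q + 1)"
      unfolding gk using z by (simp add: field_simps)
    have "z / (real q + 1) \<le> p i k" using z(2) by (simp add: divide_le_eq)
    then have "real (g i k) / (real q + 1) \<le> p i k + 1 / (real q + 1)"
      unfolding gk by (simp add: add_divide_distrib)
    then have 2: "real (g i k) / (real q + 1) < p i k + L ! i" using large[OF i] by simp
    then have "real (g i k) / (real q + 1) < 1" using p by linarith
    then have "real (g i k) < real q + 1" by (simp add: divide_less_eq)
    then have "g i k \<le> q" by linarith
    moreover have "1 \<le> g i k" using gk z(1) by linarith
    ultimately show ?thesis using 1 2 by simp
  qed
  have c: "c i \<in> open_cube d (p i) (L ! i)" if "i \<in> I" for i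
    using g[OF that] by (auto simp: c_def open_cube_def)
  \<comment> \<open>Items in the same bin have disjoint interiors and so cannot share a grid
    point.\<close>
  have "inj_on (\<lambda>i. (b i, g i)) I"
  proof (rule inj_onI)
    fix i j assume ij: "i \<in> I" "j \<in> I" "(b i, g i) = (b j, g j)"
    have "c i = c j" using ij by (simp add: c_def)
    then have "c i \<in> open_cube d (p i) (L ! i) \<inter> open_cube d (p j) (L ! j)"
      using c[OF ij(1)] c[OF ij(2)] by simp
    then have "open_cube d (p i) (L ! i) \<inter> open_cube d (p j) (L ! j) \<noteq> {}" by blast
    moreover have "i < length L" "j < length L" "b i = b j" using ij I by auto
    ultimately show "i = j" using P unfolding packing_def by blast
  qed
  moreover have "(\<lambda>i. (b i, g i)) ` I \<subseteq> (b ` I) \<times> (\<Pi>\<^sub>E k\<in>{..<d}. {1..q})"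
  proof -
    have "g i \<in> (\<Pi>\<^sub>E k\<in>{..<d}. {1..q})" if "i \<in> I" for i
    proof (rule PiE_I)
      show "g i k \<in> {1..q}" if "k \<in> {..<d}" for k using g[OF \<open>i \<in> I\<close>, of k] that by simp
      show "g i k = undefined" if "k \<notin> {..<d}" for k using that by (simp add: g_def)
    qed
    then show ?thesis by blast
  qed
  moreover have "finite (b ` I)" using I finite_subset by blast
  ultimately have "card I \<le> card ((b ` I) \<times> (\<Pi>\<^sub>E k\<in>{..<d}. {1..q}))"
    by (intro card_inj_on_le) (auto intro: finite_PiE)
  then show ?thesis by (simp add: card_cartesian_product card_PiE)
qed

section \<open>Bounded space algorithms on lists arriving in phases\<close>

lemma append_in_instances_iff: "L @ R \<in> instances \<longleftrightarrow> L \<in> instances \<and> R \<in> instances"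
  by (auto simp: instances_def)

lemma alg_bin_append: "i < length L \<Longrightarrow> alg_bin A (L @ R) i = alg_bin A L i"
  by (simp add: alg_bin_def)

lemma alg_bins_used_append:
  "alg_bins_used A (L @ R) =
     alg_bins_used A L \<union> alg_bin A (L @ R) ` {length L..<length (L @ R)}"
proof -
  have "{..<length (L @ R)} = {..<length L} \<union> {length L..<length (L @ R)}" by auto
  then show ?thesis
    unfolding alg_bins_used_def bins_used_def
    by (simp only: image_Un) (simp add: alg_bin_append)
qed

text \<open>Each item of \<open>R\<close> enters an open or a fresh bin; a bin that \<open>L\<close>
  used and that is closed after \<open>L\<close> is never again either of these. The bins open after
  \<open>L @ R\<close> are part of the claim to carry the induction.\<close>

lemma reused_bins_open:
  assumes A: "bounded_space A" and "L @ R \<in> instances"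
  shows "(open_bins A (L @ R) \<union> alg_bin A (L @ R) ` {length L..<length (L @ R)})
    \<inter> alg_bins_used A L \<subseteq> open_bins A L"
  using assms(2)
proof (induction R rule: rev_induct)
  case Nil
  then show ?case by auto
next
  case (snoc s R)
  let ?b = "bin_of A (L @ R @ [s])"
  have IH: "(open_bins A (L @ R) \<union> alg_bin A (L @ R) ` {length L..<length (L @ R)})
    \<inter> alg_bins_used A L \<subseteq> open_bins A L"
    using snoc by (simp add: append_in_instances_iff)
  have step: "?b \<in> open_bins A (L @ R) \<or> ?b \<notin> alg_bins_used A (L @ R)"
    "open_bins A (L @ R @ [s]) \<subseteq> insert ?b (open_bins A (L @ R))"
    using A snoc.prems unfolding bounded_space_def by (metis append.assoc)+
  have "alg_bins_used A L \<subseteq> alg_bins_used A (L @ R)"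
    by (subst alg_bins_used_append) blast
  then have b: "?b \<in> open_bins A L" if "?b \<in> alg_bins_used A L"
    using step(1) IH that by blast
  have "{length L..<length (L @ R @ [s])} =
      insert (length (L @ R)) {length L..<length (L @ R)}" by auto
  moreover have "alg_bin A (L @ R @ [s]) ` {length L..<length (L @ R)} =
      alg_bin A (L @ R) ` {length L..<length (L @ R)}"
    by (intro image_cong refl) (simp add: alg_bin_def)
  moreover have "alg_bin A (L @ R @ [s]) (length (L @ R)) = ?b"
    by (simp add: alg_bin_def)
  ultimately have new: "alg_bin A (L @ R @ [s]) ` {length L..<length (L @ R @ [s])} =
      insert ?b (alg_bin A (L @ R) ` {length L..<length (L @ R)})"
    by (simp only: image_insert)
  show ?case unfolding new using IH b step(2) by blast
qed

text \<open>The new items occupy at least \<open>n / q ^ d\<close> bins by the capacity bound, and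
  at most \<open>K\<close> of these bins were already in use, since such bins must be open after
  \<open>L\<close>.\<close>

lemma card_alg_bins_used_replicate:
  assumes A: "online_algorithm d A" "bounded_space A"
    and L: "L @ replicate n s \<in> instances"
    and K: "finite (open_bins A L)" "card (open_bins A L) \<le> K"
    and s: "1 / (real q + 1) < s" and q: "0 < q"
  shows "card (alg_bins_used A L) + real n / real q ^ d \<le> card (alg_bins_used A (L @ replicate n s)) + K"
proof -
  let ?L = "L @ replicate n s"
  let ?I = "{length L..<length ?L}"
  let ?B = "alg_bin A ?L ` ?I"
  have fin: "finite (alg_bins_used A L)" by (simp add: alg_bins_used_def bins_used_def)
  have "packing d ?L (alg_bin A ?L) (alg_pos A ?L)"
    using A(1) L by (simp add: online_algorithm_def)
  then have "card ?I \<le> card ?B * q ^ d"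
    by (rule card_large_items_le) (auto simp: nth_append s)
  then have "real n \<le> card ?B * real q ^ d"
    by simp (metis of_nat_le_iff of_nat_mult of_nat_power)
  then have "real n / real q ^ d \<le> card ?B" using q by (simp add: divide_le_eq)
  moreover have "card (?B \<inter> alg_bins_used A L) \<le> card (open_bins A L)"
    using reused_bins_open[OF A(2) L] K(1) by (intro card_mono) auto
  moreover have "card (alg_bins_used A L) + card ?B =
      card (alg_bins_used A ?L) + card (?B \<inter> alg_bins_used A L)"
    using card_Un_Int[OF fin, of ?B] by (simp only: alg_bins_used_append Int_commute) simp
  ultimately show ?thesis using K(2) by linarith
qed

text \<open>Summation of the previous bound over the classes, with a loss of \<open>K\<close> per
  phase. Membership in \<open>instances\<close> is carried along for the induction step.\<close>

lemma card_alg_bins_used_phases: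
  assumes A: "online_algorithm d A" "bounded_space A"
    and K: "\<forall>L\<in>instances. finite (open_bins A L) \<and> card (open_bins A L) \<le> K"
    and s: "\<And>q. q \<in> {1..M} \<Longrightarrow> 1 / (real q + 1) < s q \<and> s q \<le> 1"
  shows "concat (map (\<lambda>q. replicate (n q) (s q)) [1..<Suc M]) \<in> instances \<and>
    (\<Sum>q=1..M. real (n q) / real q ^ d) \<le>
      card (alg_bins_used A (concat (map (\<lambda>q. replicate (n q) (s q)) [1..<Suc M]))) + real M * K"
  using s
proof (induction M)
  case 0
  then show ?case by (simp add: instances_def)
next
  case (Suc M)
  let ?L = "concat (map (\<lambda>q. replicate (n q) (s q)) [1..<Suc M])"
  let ?q = "Suc M"
  have IH: "?L \<in> instances" "(\<Sum>q=1..M. real (n q) / real q ^ d) \<le> card (alg_bins_used A ?L) + real M * K"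
    using Suc by auto
  have s: "1 / (real ?q + 1) < s ?q" "s ?q \<le> 1" using Suc.prems[of ?q] by auto
  then have "0 < s ?q" by (smt (verit) divide_pos_pos of_nat_0_le_iff)
  then have L: "?L @ replicate (n ?q) (s ?q) \<in> instances"
    using IH(1) s(2) by (auto simp: instances_def)
  have "card (alg_bins_used A ?L) + real (n ?q) / real ?q ^ d \<le>
      card (alg_bins_used A (?L @ replicate (n ?q) (s ?q))) + K"
    using card_alg_bins_used_replicate[OF A L _ _ s(1)] K IH(1) by blast
  then have "(\<Sum>q=1..Suc M. real (n q) / real q ^ d) \<le>
      card (alg_bins_used A (?L @ replicate (n ?q) (s ?q))) + real (Suc M) * K"
    using IH(2) by (simp add: algebra_simps)
  moreover have "concat (map (\<lambda>q. replicate (n q) (s q)) [1..<Suc (Suc M)]) =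
      ?L @ replicate (n ?q) (s ?q)" by simp
  ultimately show ?case using L by simp
qed

section \<open>Grids of slots and the cells that can be filled\<close>

text \<open>
  The indices in \<open>C q\<close> are the coordinates in which the grid of class \<open>q\<close> is aligned with the left
  end of \<open>[0,1]\<close>; in the others it is aligned with the right end, and slot \<open>0\<close> is the rightmost one.
\<close>

definition slot_pos :: "(nat \<Rightarrow> nat set) \<Rightarrow> (nat \<Rightarrow> real) \<Rightarrow> nat \<Rightarrow> (nat \<Rightarrow> nat) \<Rightarrow> nat \<Rightarrow> real" where
  "slot_pos C s q w i = (if i \<in> C q then real (w i) * s q else 1 - (real (w i) + 1) * s q)"

text \<open>The grid cells of class \<open>q\<close> that stay clear of all earlier classes: in each
  pair of classes the later one makes way for the earlier one.\<close>

definition good_words :: "nat \<Rightarrow> (nat \<Rightarrow> nat set) \<Rightarrow> nat \<Rightarrow> (nat \<Rightarrow> nat) set" where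
  "good_words d C q = {w \<in> {..<d} \<rightarrow>\<^sub>E {..<q}. \<forall>k\<in>{1..<q}. \<exists>i<d. i \<in> C k \<and> i \<notin> C q \<and> w i = 0}"

lemma finite_good_words: "finite (good_words d C q)"
  unfolding good_words_def by (rule finite_subset[of _ "{..<d} \<rightarrow>\<^sub>E {..<q}"]) (auto intro: finite_PiE)

lemma good_words_1: "good_words d C 1 = {..<d} \<rightarrow>\<^sub>E {..<1}"
  by (auto simp: good_words_def)

text \<open>Union bound over \<open>k\<close>: a word that is bad for \<open>k\<close> avoids
  \<open>0\<close> on at least \<open>D\<close> coordinates, which leaves a fraction of at most
  \<open>(1 - 1 / q) ^ D \<le> exp (- D / q)\<close> of all words.\<close>

lemma card_good_words:
  assumes q: "0 < q"
    and D: "\<And>k. k \<in> {1..<q} \<Longrightarrow> D \<le> card ((C k - C q) \<inter> {..<d})"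
    and small: "real q * exp (- real D / real q) \<le> 1 / 2"
  shows "real q ^ d / 2 \<le> card (good_words d C q)"
proof -
  let ?W = "{..<d} \<rightarrow>\<^sub>E {..<q}"
  define S where "S k = (C k - C q) \<inter> {..<d}" for k
  define Z where "Z k = {w \<in> ?W. \<forall>i\<in>S k. w i \<noteq> 0}" for k
  have finW: "finite ?W" by (intro finite_PiE) auto
  have cardW: "card ?W = q ^ d" by (simp add: card_PiE)
  have Z: "real (card (Z k)) \<le> real q ^ d * exp (- real D / real q)" if k: "k \<in> {1..<q}" for k
  proof -
    have SD: "D \<le> card (S k)" "card (S k) \<le> d" "S k \<subseteq> {..<d}"
      using D[OF k] card_mono[of "{..<d}" "S k"] by (auto simp: S_def)
    have "Z k = (\<Pi>\<^sub>E i\<in>{..<d}. if i \<in> S k then {1..<q} else {..<q})"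
    proof (intro set_eqI iffI)
      fix w assume "w \<in> Z k"
      then show "w \<in> (\<Pi>\<^sub>E i\<in>{..<d}. if i \<in> S k then {1..<q} else {..<q})"
        by (auto simp: Z_def PiE_iff Suc_le_eq)
    next
      fix w assume w: "w \<in> (\<Pi>\<^sub>E i\<in>{..<d}. if i \<in> S k then {1..<q} else {..<q})"
      have "w i < q" if "i < d" for i using PiE_mem[OF w, of i] that by (auto split: if_splits)
      moreover have "w i \<noteq> 0" if "i \<in> S k" for i
        using PiE_mem[OF w, of i] that SD(3) by (auto split: if_splits)
      ultimately show "w \<in> Z k" using w by (auto simp: Z_def PiE_iff)
    qed
    then have "card (Z k) = (\<Prod>i<d. if i \<in> S k then q - 1 else q)"
      by (simp add: card_PiE if_distrib cong: if_cong)
    also have "\<dots> = (q - 1) ^ card (S k) * q ^ (d - card (S k))"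
    proof -
      have "{..<d} \<inter> {i. i \<in> S k} = S k" "{..<d} \<inter> - {i. i \<in> S k} = {..<d} - S k"
        using SD(3) by auto
      then show ?thesis
        using SD(3) by (simp add: prod.If_cases card_Diff_subset finite_subset)
    qed
    finally have "real (card (Z k)) = (real q - 1) ^ card (S k) * real q ^ (d - card (S k))"
      using q by (simp add: of_nat_diff)
    also have "\<dots> = real q ^ d * (1 - 1 / real q) ^ card (S k)"
    proof -
      have "real q ^ d = real q ^ (d - card (S k)) * real q ^ card (S k)"
        using SD(2) by (simp flip: power_add)
      moreover have "(real q - 1) ^ card (S k) = real q ^ card (S k) * (1 - 1 / real q) ^ card (S k)"
        using q by (simp add: right_diff_distrib flip: power_mult_distrib)
      ultimately show ?thesis by simp
    qed
    also have "\<dots> \<le> real q ^ d * (1 - 1 / real q) ^ D"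
      using q SD(1) by (intro mult_left_mono power_decreasing) auto
    also have "\<dots> \<le> real q ^ d * exp (- 1 / real q) ^ D"
      using q exp_ge_add_one_self[of "- 1 / real q"] by (intro mult_left_mono power_mono) auto
    also have "exp (- 1 / real q) ^ D = exp (- real D / real q)"
      by (simp flip: exp_of_nat_mult)
    finally show ?thesis .
  qed
  have "?W - good_words d C q \<subseteq> (\<Union>k\<in>{1..<q}. Z k)"
    by (auto simp: good_words_def Z_def S_def)
  then have "card (?W - good_words d C q) \<le> card (\<Union>k\<in>{1..<q}. Z k)"
    using finW by (intro card_mono) (auto simp: Z_def)
  also have "\<dots> \<le> (\<Sum>k\<in>{1..<q}. card (Z k))" by (rule card_UN_le) simp
  finally have "real (card (?W - good_words d C q)) \<le> (\<Sum>k\<in>{1..<q}. real (card (Z k)))"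
    by (metis of_nat_le_iff of_nat_sum)
  also have "\<dots> \<le> (\<Sum>k\<in>{1..<q}. real q ^ d * exp (- real D / real q))"
    by (intro sum_mono Z)
  also have "\<dots> \<le> real q * (real q ^ d * exp (- real D / real q))"
    by (simp add: mult_right_mono)
  also have "\<dots> \<le> real q ^ d * (1 / 2)"
    using mult_left_mono[OF small, of "real q ^ d"] by (simp add: algebra_simps)
  finally have "real (card (?W - good_words d C q)) \<le> real q ^ d / 2" by simp
  moreover have "card (?W - good_words d C q) = q ^ d - card (good_words d C q)"
    using cardW finite_good_words[of d C q]
    by (subst card_Diff_subset) (auto simp: good_words_def)
  moreover have "card (good_words d C q) \<le> q ^ d"
    unfolding cardW[symmetric] by (intro card_mono finW) (auto simp: good_words_def)
  ultimately show ?thesis by (simp add: of_nat_diff)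
qed

lemma slot_disjoint_same_class:
  assumes "w \<in> {..<d} \<rightarrow>\<^sub>E {..<q}" "w' \<in> {..<d} \<rightarrow>\<^sub>E {..<q}" "w \<noteq> w'" and s: "0 < s q"
  shows "open_cube d (slot_pos C s q w) (s q) \<inter> open_cube d (slot_pos C s q w') (s q) = {}"
proof -
  obtain i where i: "i < d" "w i \<noteq> w' i"
    using PiE_ext[OF assms(1,2)] assms(3) by auto
  have *: "(real m + 1) * s q \<le> real n * s q" if "m < n" for m n :: nat
    using that s by (intro mult_right_mono) auto
  show ?thesis
  proof (rule open_cubes_disjointI[OF i(1)])
    show "slot_pos C s q w i + s q \<le> slot_pos C s q w' i \<or>
        slot_pos C s q w' i + s q \<le> slot_pos C s q w i"
      using *[of "w i" "w' i"] *[of "w' i" "w i"] i(2)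
      by (cases "w i < w' i") (auto simp: slot_pos_def algebra_simps)
  qed
qed

text \<open>In some coordinate of \<open>C k - C l\<close> the later item lies in
  \<open>[1 - s l, 1]\<close>, while all slots of class \<open>k\<close> lie in
  \<open>[0, k * s k]\<close>.\<close>

lemma slot_disjoint_classes:
  assumes w: "w \<in> {..<d} \<rightarrow>\<^sub>E {..<k}" and w': "w' \<in> good_words d C l"
    and kl: "1 \<le> k" "k < l" and s: "0 < s k" "real k * s k + s l \<le> 1"
  shows "open_cube d (slot_pos C s k w) (s k) \<inter> open_cube d (slot_pos C s l w') (s l) = {}"
proof -
  obtain i where i: "i < d" "i \<in> C k" "i \<notin> C l" "w' i = 0"
  proof -
    have "\<forall>k\<in>{1..<l}. \<exists>i<d. i \<in> C k \<and> i \<notin> C l \<and> w' i = 0"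
      using w' by (simp add: good_words_def)
    moreover have "k \<in> {1..<l}" using kl by simp
    ultimately show ?thesis using that by blast
  qed
  have "w i < k" using w i(1) by auto
  then have "(real (w i) + 1) * s k \<le> real k * s k" using s(1) by (intro mult_right_mono) auto
  then show ?thesis
    using i s(2) by (intro open_cubes_disjointI[OF i(1)]) (auto simp: slot_pos_def algebra_simps)
qed

lemma slot_in_unit_cube:
  assumes w: "w \<in> {..<d} \<rightarrow>\<^sub>E {..<q}" and s: "0 < s q" "real q * s q \<le> 1"
  shows "cube d (slot_pos C s q w) (s q) \<subseteq> unit_cube d"
proof -
  have "0 \<le> slot_pos C s q w i \<and> slot_pos C s q w i + s q \<le> 1" if "i < d" for i
  proof -
    have "w i < q" using w that by auto
    then have "(real (w i) + 1) * s q \<le> real q * s q" using s(1) by (intro mult_right_mono) auto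
    moreover have "0 \<le> real (w i) * s q" using s(1) by simp
    ultimately show ?thesis using s(1,2) by (auto simp: slot_pos_def algebra_simps)
  qed
  then show ?thesis using s(1) by (simp add: cube_subset_unit_cube_iff)
qed

section \<open>The offline optimum of the instance\<close>

lemma OPT_le:
  assumes "packing d L b p"
  shows "OPT d L \<le> card (bins_used L b)"
  unfolding OPT_def by (rule Least_le) (use assms in blast)

lemma OPT_obtain:
  assumes "packing d L b p"
  obtains b' p' where "packing d L b' p'" "card (bins_used L b') = OPT d L"
proof -
  have "\<exists>b' p'. packing d L b' p' \<and> card (bins_used L b') = OPT d L"
    unfolding OPT_def by (rule LeastI_ex) (use assms in blast)
  then show ?thesis using that by blast
qed

text \<open>Upper bound: \<open>N\<close> identical bins, each holding one item per good word of
  every class. Lower bound: the items of class 1 have side greater than \<open>1 / 2\<close>, so no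
  two of them share a bin.\<close>

lemma OPT_phases:
  fixes N :: nat
  assumes M: "1 \<le> M"
    and pos: "\<And>q. q \<in> {1..M} \<Longrightarrow> 1 / (real q + 1) < s q \<and> real q * s q \<le> 1"
    and sep: "\<And>k l. 1 \<le> k \<Longrightarrow> k < l \<Longrightarrow> l \<le> M \<Longrightarrow> real k * s k + s l \<le> 1"
  shows "OPT d (concat (map (\<lambda>q. replicate (N * card (good_words d C q)) (s q)) [1..<Suc M])) = N"
    (is "OPT d ?L = N")
proof -
  have s0: "0 < s q" if "q \<in> {1..M}" for q
    using pos[OF that] by (smt (verit) divide_pos_pos of_nat_0_le_iff)
  \<comment> \<open>An item is labelled by its class, its word and the number of its bin.
    Enumerating the labels class by class reproduces the order of arrival.\<close>
  define X where "X q = {q} \<times> good_words d C q \<times> {..<N}" for q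
  have "\<exists>xs. set xs = X q \<and> distinct xs" for q
    by (rule finite_distinct_list) (simp add: X_def finite_good_words)
  then obtain ys where ys: "\<And>q. set (ys q) = X q" "\<And>q. distinct (ys q)" by metis
  define xs where "xs = concat (map ys [1..<Suc M])"
  have set_xs: "set xs = (\<Union>q\<in>{1..M}. X q)"
    by (simp add: xs_def ys atLeastLessThanSuc_atLeastAtMost del: upt_Suc)
  have "length (ys q) = N * card (good_words d C q)" for q
    using distinct_card[OF ys(2)[of q]] by (simp add: ys X_def card_cartesian_product mult.commute)
  then have "map (\<lambda>x. s (fst x)) (ys q) = replicate (N * card (good_words d C q)) (s q)" for q
    by (intro replicate_eqI) (auto simp: ys X_def)
  then have L: "?L = map (\<lambda>x. s (fst x)) xs"
    by (simp add: xs_def map_concat o_def)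
  have "distinct (concat (map ys [1..<n]))" for n
  proof (induction n)
    case (Suc n)
    have "set (ys n) \<inter> set (concat (map ys [1..<n])) = {}" by (auto simp: ys X_def)
    then show ?case using Suc ys(2)[of n] by auto
  qed simp
  then have dist: "distinct xs" unfolding xs_def .
  define b where "b i = snd (snd (xs ! i))" for i
  define p where "p i = slot_pos C s (fst (xs ! i)) (fst (snd (xs ! i)))" for i
  have P: "packing d ?L b p"
    unfolding packing_def L length_map
  proof (intro conjI allI impI)
    fix i assume i: "i < length xs"
    then have "xs ! i \<in> set xs" by simp
    then obtain q w t where x: "xs ! i = (q, w, t)" "q \<in> {1..M}" "w \<in> good_words d C q"
      by (auto simp: set_xs X_def)
    then show "cube d (p i) (map (\<lambda>x. s (fst x)) xs ! i) \<subseteq> unit_cube d"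
      using slot_in_unit_cube[of w d q s C] s0 pos i by (auto simp: p_def good_words_def)
  next
    fix i j assume i: "i < length xs" and j: "j < length xs" and ij: "i \<noteq> j \<and> b i = b j"
    have "xs ! i \<in> set xs" using i by simp
    then obtain q w t where x: "xs ! i = (q, w, t)" "q \<in> {1..M}" "w \<in> good_words d C q"
      by (auto simp: set_xs X_def)
    have "xs ! j \<in> set xs" using j by simp
    then obtain q' w' t' where y: "xs ! j = (q', w', t')" "q' \<in> {1..M}" "w' \<in> good_words d C q'"
      by (auto simp: set_xs X_def)
    have ne: "q \<noteq> q' \<or> w \<noteq> w'"
      using ij dist i j x(1) y(1) by (auto simp: nth_eq_iff_index_eq[symmetric] b_def)
    have W: "w \<in> {..<d} \<rightarrow>\<^sub>E {..<q}" "w' \<in> {..<d} \<rightarrow>\<^sub>E {..<q'}"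
      using x(3) y(3) by (auto simp: good_words_def)
    have "open_cube d (slot_pos C s q w) (s q) \<inter> open_cube d (slot_pos C s q' w') (s q') = {}"
    proof (cases q q' rule: linorder_cases)
      case less
      then show ?thesis
        using slot_disjoint_classes[OF W(1) y(3), of s] x(2) y(2) s0 sep by auto
    next
      case equal
      then show ?thesis
        using slot_disjoint_same_class[of w d q w' s C] W ne s0 x(2) by auto
    next
      case greater
      then show ?thesis
        using slot_disjoint_classes[OF W(2) x(3), of s] x(2) y(2) s0 sep by auto
    qed
    then show "open_cube d (p i) (map (\<lambda>x. s (fst x)) xs ! i) \<inter>
        open_cube d (p j) (map (\<lambda>x. s (fst x)) xs ! j) = {}"
      using i j x y by (simp add: p_def)
  qed
  have "bins_used ?L b \<subseteq> {..<N}"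
  proof -
    have "snd (snd x) < N" if "x \<in> set xs" for x using that by (auto simp: set_xs X_def)
    moreover have "length ?L = length xs" by (simp only: L length_map)
    ultimately show ?thesis unfolding bins_used_def b_def
      by (simp add: image_subset_iff del: upt_Suc split_paired_All)
  qed
  then have "card (bins_used ?L b) \<le> N" using card_mono[of "{..<N}"] by fastforce
  then have le: "OPT d ?L \<le> N" using OPT_le[OF P] by simp
  obtain b' p' where P': "packing d ?L b' p'" "card (bins_used ?L b') = OPT d ?L"
    using OPT_obtain[OF P] .
  \<comment> \<open>Class 1 has a single good word, so the list starts with exactly \<open>N\<close>
    items of this class.\<close>
  define R where
    "R = concat (map (\<lambda>q. replicate (N * card (good_words d C q)) (s q)) [Suc 1..<Suc M])"
  have "[1..<Suc M] = 1 # [Suc 1..<Suc M]"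
    by (rule upt_conv_Cons) (use M in simp)
  moreover have "card (good_words d C 1) = 1"
    unfolding good_words_1 by (simp add: card_PiE)
  ultimately have L1: "?L = replicate N (s 1) @ R"
    unfolding R_def by (simp only: list.map concat.simps mult_1_right)
  have len: "N \<le> length ?L" unfolding L1 by simp
  have large: "1 / (real 1 + 1) < ?L ! i" if "i \<in> {..<N}" for i
    unfolding L1 using that pos[of 1] M by (simp add: nth_append)
  have "card {..<N} \<le> card (b' ` {..<N}) * 1 ^ d"
    by (rule card_large_items_le[OF P'(1) _ large]) (use len in auto)
  also have "\<dots> = card (b' ` {..<N})" by simp
  also have "\<dots> \<le> card (bins_used ?L b')"
    unfolding bins_used_def by (rule card_mono[OF _ image_mono]) (use len in auto)
  finally have "N \<le> OPT d ?L" unfolding P'(2) by simp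
  with le show ?thesis by (rule antisym)
qed

section \<open>Side lengths and the bound for a given number of classes\<close>

text \<open>
  The excess over \<open>1 / (q + 1)\<close> is so small that \<open>k\<close> items of class \<open>k\<close> and one item of a later
  class still fit side by side.
\<close>

definition side :: "nat \<Rightarrow> nat \<Rightarrow> real" where
  "side M q = 1 / (real q + 1) + 1 / (real M + 2) ^ 3"

lemma side_gt: "1 / (real q + 1) < side M q"
  by (simp add: side_def)

text \<open>Without the excesses the sum is at most \<open>1 - 1 / (k + 1) + 1 / (k + 2)\<close>.
  The remaining room \<open>1 / ((k + 1) * (k + 2))\<close> suffices for \<open>k + 1\<close>
  excesses of \<open>1 / (M + 2) ^ 3\<close> each.\<close>

lemma side_sep:
  assumes "k < l" "k \<le> M"
  shows "real k * side M k + side M l \<le> 1"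
proof -
  let ?k = "real k" and ?M = "real M"
  have "1 / (real l + 1) \<le> 1 / (?k + 2)" using assms by (intro divide_left_mono) auto
  moreover have "?k * (1 / (?k + 1)) = 1 - 1 / (?k + 1)" by (simp add: field_simps)
  moreover have "(?k + 1) * (1 / (?M + 2) ^ 3) \<le> 1 / (?k + 1) - 1 / (?k + 2)"
  proof -
    have "(?k + 1) * ((?k + 1) * (?k + 2)) \<le> (?M + 2) * ((?M + 2) * (?M + 2))"
      using assms by (intro mult_mono) auto
    moreover have "x * (1 / y) \<le> 1 / z" if "x * z \<le> y" "0 < y" "0 < z" for x y z :: real
      using that by (simp add: field_simps)
    ultimately have "(?k + 1) * (1 / (?M + 2) ^ 3) \<le> 1 / ((?k + 1) * (?k + 2))"
      by (simp add: power3_eq_cube)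
    also have "\<dots> = 1 / (?k + 1) - 1 / (?k + 2)" by (simp add: divide_simps)
    finally show ?thesis .
  qed
  moreover have "?k * side M k + side M l =
      ?k * (1 / (?k + 1)) + 1 / (real l + 1) + (?k + 1) * (1 / (?M + 2) ^ 3)"
    by (simp add: side_def distrib_left distrib_right add_divide_distrib)
  ultimately show ?thesis by linarith
qed

text \<open>Each class forces at least \<open>N / 2 - K\<close> bins, which is at least
  \<open>N / 4\<close> once \<open>N > 4 * K\<close>; the optimum is \<open>N\<close>.\<close>

lemma asymptotic_ratio_ge:
  assumes A: "A \<in> online_bounded_space_algorithms d" and M: "1 \<le> M"
    and C: "\<And>q. q \<in> {1..M} \<Longrightarrow> real q ^ d / 2 \<le> card (good_words d C q)"
  shows "ereal (real M / 4) \<le> asymptotic_ratio d A"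
proof -
  have A': "online_algorithm d A" "bounded_space A"
    using A by (auto simp: online_bounded_space_algorithms_def)
  then obtain K where K: "\<forall>L\<in>instances. finite (open_bins A L) \<and> card (open_bins A L) \<le> K"
    unfolding bounded_space_def by blast
  \<comment> \<open>The second part is separation from class \<open>q + 1\<close>, possibly the
    fictitious class \<open>M + 1\<close>, whose side is positive.\<close>
  have pos: "1 / (real q + 1) < side M q \<and> real q * side M q \<le> 1" if "q \<in> {1..M}" for q
    using side_gt[of q M] side_gt[of "Suc q" M] side_sep[of q "Suc q" M] that
    by (smt (verit) atLeastAtMost_iff divide_pos_pos lessI of_nat_0_le_iff)
  have le1: "side M q \<le> 1" if "q \<in> {1..M}" for q
  proof -
    have "0 < side M q" by (simp add: side_def add_pos_pos)
    then have "1 * side M q \<le> real q * side M q" using that by (intro mult_right_mono) auto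
    then show ?thesis using pos[OF that] by simp
  qed
  define L where
    "L N = concat (map (\<lambda>q. replicate (N * card (good_words d C q)) (side M q)) [1..<Suc M])" for N
  have OPT: "OPT d (L N) = N" for N
    unfolding L_def by (rule OPT_phases[OF M pos side_sep]) auto
  have "ereal (real M / 4) \<le> (SUP L\<in>{L\<in>instances. OPT d L = N}.
       ereal (real (card (alg_bins_used A L)) / real (OPT d L)))" if N: "4 * K < N" for N
  proof (rule SUP_upper2[of "L N"])
    have phases: "L N \<in> instances \<and> (\<Sum>q=1..M. real (N * card (good_words d C q)) / real q ^ d) \<le>
        card (alg_bins_used A (L N)) + real M * K"
      unfolding L_def
      by (rule card_alg_bins_used_phases[OF A' K]) (use pos le1 in auto)
    then show "L N \<in> {L \<in> instances. OPT d L = N}" using OPT by simp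
    have "real N / 2 \<le> real (N * card (good_words d C q)) / real q ^ d" if "q \<in> {1..M}" for q
      using mult_left_mono[OF C[OF that], of "real N"] that by (simp add: field_simps)
    then have "(\<Sum>q=1..M. real N / 2) \<le> (\<Sum>q=1..M. real (N * card (good_words d C q)) / real q ^ d)"
      by (intro sum_mono)
    then have "real M * (real N / 2) \<le> card (alg_bins_used A (L N)) + real M * K"
      using phases by simp
    moreover have "real M * real K \<le> real M * (real N / 4)"
      using N by (intro mult_left_mono) auto
    ultimately have "real M / 4 * real N \<le> card (alg_bins_used A (L N))" by simp
    then show "ereal (real M / 4) \<le> ereal (card (alg_bins_used A (L N)) / OPT d (L N))"
      using N by (simp add: OPT le_divide_eq)
  qed
  then have "eventually (\<lambda>N. ereal (real M / 4) \<le> (SUP L\<in>{L\<in>instances. OPT d L = N}.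
       ereal (real (card (alg_bins_used A L)) / real (OPT d L)))) sequentially"
    using eventually_gt_at_top[of "4 * K"] by (rule eventually_mono[rotated])
  then show ?thesis
    unfolding asymptotic_ratio_def
    by (intro order_trans[OF Liminf_bounded Liminf_le_Limsup]) auto
qed

section \<open>Choice of the code and of the constants\<close>

lemma many_good_words:
  assumes d: "32 \<le> d" and M: "real M \<le> real d / (8 * ln (real d))"
  obtains C where "\<And>q. q \<in> {1..M} \<Longrightarrow> real q ^ d / 2 \<le> card (good_words d C q)"
proof -
  have ln2: "2 \<le> ln (real d)"
  proof -
    have "exp 2 = exp 1 * (exp 1 :: real)" by (simp flip: exp_add)
    also have "\<dots> \<le> 3 * 3" using exp_le by (intro mult_mono) auto
    finally have "exp 2 \<le> real d" using d by linarith
    then show ?thesis using d by (subst ln_ge_iff) auto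
  qed
  \<comment> \<open>The code of length \<open>2 * n\<close> has to fit into the \<open>d\<close>
    coordinates; the largest power of two with \<open>2 * n \<le> d\<close> also gives
    \<open>d < 4 * n\<close>.\<close>
  obtain m where m: "2 ^ m \<le> d div 2" "d div 2 < 2 ^ Suc m"
    using ex_power_ivl1[of 2 "d div 2"] div_le_mono[OF d, of 2] by auto
  define n :: nat where "n = 2 ^ m"
  have n: "2 * n \<le> d" "d < 4 * n" using m unfolding n_def by auto
  obtain C :: "nat \<Rightarrow> nat set" where C: "\<And>k l. k < n \<Longrightarrow> l < n \<Longrightarrow> k \<noteq> l \<Longrightarrow>
      2 * card ((C k - C l) \<inter> {..<2 * n}) = n"
    using asymmetric_code[of m] unfolding n_def by blast
  \<comment> \<open>Together with \<open>n > d / 4\<close> this leaves a separate codeword for each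
    of the classes \<open>1, \<dots>, M\<close>.\<close>
  have "real M \<le> real d / 16"
  proof -
    have "real d / (8 * ln (real d)) \<le> real d / 16" using ln2 by (intro divide_left_mono) auto
    then show ?thesis using M by simp
  qed
  then have Mn: "M < n" using n by linarith
  have "real q ^ d / 2 \<le> card (good_words d C q)" if q: "q \<in> {1..M}" for q
  proof (rule card_good_words)
    show "0 < q" using q by simp
    show "n div 2 \<le> card ((C k - C q) \<inter> {..<d})" if "k \<in> {1..<q}" for k
    proof -
      have "2 * card ((C k - C q) \<inter> {..<2 * n}) = n" using C[of k q] that q Mn by auto
      moreover have "card ((C k - C q) \<inter> {..<2 * n}) \<le> card ((C k - C q) \<inter> {..<d})"
        using n by (intro card_mono) auto
      ultimately show ?thesis by linarith
    qed
    \<comment> \<open>Evenness makes \<open>n div 2\<close> exact, hence at least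
      \<open>d / 8\<close>. The bound on \<open>M\<close> then turns the exponential into at most
      \<open>1 / d\<close>.\<close>
    have "even n" using n d by (cases m) (auto simp: n_def)
    then have "real d / 8 \<le> real (n div 2)" using n(2) by (auto elim!: evenE)
    moreover have qM: "real q \<le> real d / (8 * ln (real d))" using q M by auto
    then have "ln (real d) * real q \<le> real d / 8" using ln2 by (simp add: field_simps)
    ultimately have "ln (real d) * real q \<le> real (n div 2)" by linarith
    then have "ln (real d) \<le> real (n div 2) / real q" using q by (simp add: le_divide_eq)
    then have "exp (- real (n div 2) / real q) \<le> exp (- ln (real d))" by simp
    also have "\<dots> = 1 / real d" using d by (simp add: exp_minus inverse_eq_divide)
    finally have "real q * exp (- real (n div 2) / real q) \<le> real q * (1 / real d)"
      by (intro mult_left_mono) auto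
    also have "\<dots> \<le> 1 / 2"
    proof -
      have "real q \<le> real d / 2" using q Mn n by auto
      then show ?thesis using d by (simp add: field_simps)
    qed
    finally show "real q * exp (- real (n div 2) / real q) \<le> 1 / 2" .
  qed
  then show ?thesis using that by blast
qed

theorem theorem1:
  shows "\<exists>c>0. \<exists>d0. \<forall>d\<ge>d0.
    ereal (c * real d / ln (real d)) \<le> optimal_asymptotic_ratio d \<and>
    (\<forall>A\<in>online_bounded_space_algorithms d.
       ereal (c * real d / ln (real d)) \<le> asymptotic_ratio d A)"
proof -
  have d0: "1 \<le> real d / (8 * ln (real d))" if "256 \<le> d" for d
  proof -
    \<comment> \<open>Passing to the square root bounds \<open>8 * ln d\<close> by
      \<open>16 * sqrt d\<close>, which is at most \<open>d\<close> because \<open>256\<close> is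
      the square of \<open>16\<close>.\<close>
    have "ln (real d) = 2 * ln (sqrt (real d))" using that by (simp add: ln_sqrt)
    also have "\<dots> \<le> 2 * sqrt (real d)"
      using ln_le_minus_one[of "sqrt (real d)"] that by simp
    finally have "8 * ln (real d) \<le> 16 * sqrt (real d)" by simp
    also have "\<dots> \<le> sqrt (real d) * sqrt (real d)"
      using that by (intro mult_right_mono real_le_rsqrt) auto
    also have "\<dots> = real d" by simp
    finally show ?thesis using that by (simp add: le_divide_eq)
  qed
  have main: "ereal (1 / 64 * real d / ln (real d)) \<le> asymptotic_ratio d A"
    if d: "256 \<le> d" and A: "A \<in> online_bounded_space_algorithms d" for d A
  proof -
    define x where "x = real d / (8 * ln (real d))"
    define M where "M = nat \<lfloor>x\<rfloor>"
    have x: "1 \<le> x" "32 \<le> d" using d0[OF d] d by (auto simp: x_def)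
    have "real M = \<lfloor>x\<rfloor>" using x(1) by (simp add: M_def)
    moreover have "1 \<le> M" using x(1) by (simp add: M_def le_nat_iff)
    ultimately have M: "real M \<le> x" "x / 2 \<le> real M" "1 \<le> M" by linarith+
    obtain C where "\<And>q. q \<in> {1..M} \<Longrightarrow> real q ^ d / 2 \<le> card (good_words d C q)"
      using many_good_words[OF x(2)] M(1) unfolding x_def by blast
    then have "ereal (real M / 4) \<le> asymptotic_ratio d A"
      using asymptotic_ratio_ge[OF A M(3)] by blast
    \<comment> \<open>The constant is the product of \<open>1 / 8\<close> from \<open>x\<close>,
      \<open>1 / 2\<close> from rounding \<open>x \<ge> 1\<close> down to \<open>M\<close>, and
      \<open>1 / 4\<close> from the bound \<open>M / 4\<close>.\<close>
    moreover have "1 / 64 * real d / ln (real d) = x / 8" by (simp add: x_def)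
    ultimately show ?thesis using M(2) by (elim order_trans[rotated]) simp
  qed
  show ?thesis
    using main unfolding optimal_asymptotic_ratio_def
    by (intro exI[of _ "1/64"] conjI exI[of _ 256]) (auto intro!: INF_greatest)
qed

end
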